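(* For every sequence $\{c_n\}_{n\ge 1}$ of real numbers, the set of parameters $t\in\mathbb{R}_+$ for which all solutions $\{q_k\}_{k\ge 0}$ of the difference equation $$q_{k+1}-(2+tc_k)q_k+q_{k-1}=0,\qquad k\ge 1,$$ are bounded has finite Lebesgue measure.
   Context: $\mathbb{R}_+=[0,\infty)$. A solution is a real sequence $\{q_k\}_{k\ge0}$ satisfying the equation for all $k\ge1$. *)

theory Defs
  imports "HOL-Analysis.Analysis"
begin

(* The coefficients are indexed from 1 on; the value c 0 is never used. *)
definition is_solution :: "(nat \<Rightarrow> real) \<Rightarrow> real \<Rightarrow> (nat \<Rightarrow> real) \<Rightarrow> bool" where
  "is_solution c t q \<longleftrightarrow> (\<forall>k\<ge>1. q (k + 1) - (2 + t * c k) * q k + q (k - 1) = 0)"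

definition stable_parameters :: "(nat \<Rightarrow> real) \<Rightarrow> real set" where
  "stable_parameters c = {t \<in> {0..}. \<forall>q. is_solution c t q \<longrightarrow> bounded (range q)}"

end

theory Submission
  imports Defs "HOL-Computational_Algebra.Polynomial"
begin

text \<open>
  Let \<open>Q\<^sub>n(t)\<close> be the solution with initial values \<open>0, 1\<close>. It is a polynomial in \<open>t\<close> of degree
  less than \<open>n\<close>, and a stable parameter \<open>t\<close> belongs to one of the closed sets
  \<open>F C = {t \<ge> 0. \<forall>n. \<bar>Q\<^sub>n(t)\<bar> \<le> C}\<close>, which increase with \<open>C\<close>. If the stable set had infinite measure,
  two facts about the number \<open>Q\<^sub>n(\<i>)\<close> would contradict each other.

  \<^item> It grows exponentially. At a single stable \<open>t > 0\<close> there are two bounded solutions with Wronskian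
    \<open>1\<close>, so their slopes cannot become small; hence coefficients \<open>c\<^sub>k\<close> with \<open>\<bar>c\<^sub>k\<bar> \<ge> \<delta>\<close> occur in every window
    of some fixed length (\<open>bounded_imp_recurring_coefficients\<close>). At the imaginary parameter \<open>\<i>\<close> the
    coefficient has modulus \<open>\<bar>2 + \<i> c\<^sub>k\<bar> = sqrt (4 + c\<^sub>k\<^sup>2) \<ge> 2\<close> whatever the sign of \<open>c\<^sub>k\<close>, so \<open>\<bar>Q\<^sub>n(\<i>)\<bar>\<close> is convex
    in \<open>n\<close> and gains a fixed factor in every window (\<open>growth_at_ii\<close>).

  \<^item> It grows more slowly than any exponential. In terms of potential theory, a subset of the half-line of
    infinite measure is not thin at infinity, so the Green functions of its bounded parts, with pole at
    infinity, tend to \<open>0\<close> at \<open>\<i>\<close>; by the Bernstein--Walsh inequality, polynomials of degree less than \<open>n\<close>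
    that are bounded by \<open>C\<close> on the set are \<open>O(n e\<^bsup>\<kappa>n\<^esup>)\<close> at \<open>\<i>\<close> for every \<open>\<kappa> > 0\<close>. The proof given here is
    elementary: \<open>n\<close> interpolation nodes are chosen in \<open>F C\<close> for which all Lagrange basis polynomials are
    \<open>O(e\<^bsup>\<kappa>n\<^esup>)\<close> at \<open>\<i>\<close> (\<open>node_rate_all\<close>). Nodes in one dyadic block do this for some \<open>\<kappa>\<close>. If it can be done for \<open>\<kappa>\<close>,
    it can be done for \<open>9\<kappa>/10\<close>: a fifth of the nodes is moved to a far away block \<open>[R, 2R]\<close>
    (\<open>node_rate_improve\<close>).

  The second fact must hold with one \<open>C\<close> for all \<open>n\<close>. That is why all nodes come from a bounded part of one
  \<open>F C\<close>, while \<open>C\<close> may depend on \<open>\<kappa>\<close>.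
\<close>

section \<open>Lagrange interpolation at the point \<open>\<i>\<close>\<close>

lemma lagrange_interpolation:
  fixes p :: "'a::field poly"
  assumes fin: "finite X" and deg: "degree p < card X"
  shows "poly p z = (\<Sum>x\<in>X. poly p x * (\<Prod>y\<in>X - {x}. (z - y) / (x - y)))"
proof -
  define L where "L = (\<Sum>x\<in>X. smult (poly p x) (\<Prod>y\<in>X - {x}. smult (1 / (x - y)) [:- y, 1:]))"
  have poly_L: "poly L w = (\<Sum>x\<in>X. poly p x * (\<Prod>y\<in>X - {x}. (w - y) / (x - y)))" for w
    by (simp add: L_def poly_sum poly_prod diff_divide_distrib)
  have "degree L \<le> card X - 1"
    unfolding L_def
  proof (intro degree_sum_le fin)
    fix x assume x: "x \<in> X"
    have "degree (\<Prod>y\<in>X - {x}. smult (1 / (x - y)) [:- y, 1:])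
        \<le> (\<Sum>y\<in>X - {x}. degree (smult (1 / (x - y)) [:- y, 1:]))"
      using degree_prod_sum_le[OF finite_Diff[OF fin]] unfolding o_def .
    also have "\<dots> \<le> (\<Sum>y\<in>X - {x}. 1)"
      by (intro sum_mono order.trans[OF degree_smult_le]) auto
    also have "\<dots> = card X - 1"
      using fin x by simp
    finally show "degree (smult (poly p x) (\<Prod>y\<in>X - {x}. smult (1 / (x - y)) [:- y, 1:])) \<le> card X - 1"
      using degree_smult_le order.trans by blast
  qed
  hence "degree L < card X"
    using deg by simp
  moreover have "poly L w = poly p w" if w: "w \<in> X" for w
  proof -
    have "poly L w = (\<Sum>x\<in>X. if x = w then poly p w else 0)"
      unfolding poly_L
    proof (rule sum.cong[OF refl])
      fix x assume "x \<in> X"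
      show "poly p x * (\<Prod>y\<in>X - {x}. (w - y) / (x - y)) = (if x = w then poly p w else 0)"
      proof (cases "x = w")
        case True
        have "(\<Prod>y\<in>X - {x}. (w - y) / (x - y)) = 1"
          unfolding True by (intro prod.neutral ballI divide_self) auto
        thus ?thesis using True by (simp only: if_True mult_1_right refl)
      next
        case False
        hence "(\<Prod>y\<in>X - {x}. (w - y) / (x - y)) = 0"
          using fin w by (intro prod_zero bexI[of _ w]) auto
        thus ?thesis using False by simp
      qed
    qed
    thus ?thesis using fin w by simp
  qed
  ultimately have "p = L"
    using deg by (intro poly_eqI_degree[of X]) auto
  hence "poly p z = poly L z" by (rule arg_cong)
  thus ?thesis by (simp only: poly_L)
qed

text \<open>The modulus at \<open>\<i>\<close> of the Lagrange basis polynomial of the node \<open>x\<close>.\<close>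

definition node_factor :: "real set \<Rightarrow> real \<Rightarrow> real" where
  "node_factor X x = (\<Prod>y\<in>X - {x}. cmod (\<i> - of_real y) / \<bar>x - y\<bar>)"

lemma interpolation_bound:
  fixes p :: "complex poly" and B C :: real
  assumes fin: "finite X" and deg: "degree p < card X"
    and p: "\<And>x. x \<in> X \<Longrightarrow> cmod (poly p (of_real x)) \<le> C"
    and B: "\<And>x. x \<in> X \<Longrightarrow> node_factor X x \<le> B"
  shows "cmod (poly p \<i>) \<le> card X * (C * B)"
proof -
  define X' where "X' = complex_of_real ` X"
  have inj: "inj_on complex_of_real A" for A
    by (simp add: inj_on_def)
  have card: "card X' = card X" and fin': "finite X'"
    using fin by (simp_all add: X'_def card_image[OF inj])
  have prod: "cmod (\<Prod>y\<in>X' - {of_real x}. (\<i> - y) / (of_real x - y)) = node_factor X x" for x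
  proof -
    have *: "X' - {of_real x} = complex_of_real ` (X - {x})"
      by (auto simp: X'_def)
    show ?thesis
      unfolding * node_factor_def
      by (simp add: prod.reindex[OF inj] prod_norm[symmetric] norm_divide flip: of_real_diff)
  qed
  have "poly p \<i> = (\<Sum>x\<in>X. poly p (of_real x) * (\<Prod>y\<in>X' - {of_real x}. (\<i> - y) / (of_real x - y)))"
    using lagrange_interpolation[OF fin', of p \<i>] deg card
    by (simp add: X'_def sum.reindex[OF inj])
  also have "cmod \<dots> \<le> (\<Sum>x\<in>X. C * B)"
  proof (rule sum_norm_le)
    fix x assume x: "x \<in> X"
    have "0 \<le> C" using p[OF x] norm_ge_zero order.trans by blast
    thus "cmod (poly p (of_real x) * (\<Prod>y\<in>X' - {of_real x}. (\<i> - y) / (of_real x - y))) \<le> C * B"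
      unfolding norm_mult prod
      using p[OF x] B[OF x] by (intro mult_mono) (auto simp: node_factor_def intro!: prod_nonneg)
  qed
  finally show ?thesis by simp
qed

definition good_nodes :: "real set \<Rightarrow> nat \<Rightarrow> real \<Rightarrow> real set \<Rightarrow> bool" where
  "good_nodes K n B X \<longleftrightarrow> finite X \<and> X \<subseteq> K \<and> card X = n \<and> (\<forall>x\<in>X. node_factor X x \<le> B)"

lemma node_factor_Un:
  assumes "finite X" "finite Y" "X \<inter> Y = {}" "x \<in> X"
  shows "node_factor (X \<union> Y) x = node_factor X x * (\<Prod>y\<in>Y. cmod (\<i> - of_real y) / \<bar>x - y\<bar>)"
proof -
  have "(X \<union> Y) - {x} = (X - {x}) \<union> Y" using assms by auto
  moreover have "(X - {x}) \<inter> Y = {}" using assms by auto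
  ultimately show ?thesis
    unfolding node_factor_def using assms by (simp add: prod.union_disjoint)
qed

lemma cmod_i_minus_le: "0 \<le> y \<Longrightarrow> cmod (\<i> - of_real y) \<le> 1 + y"
  using norm_triangle_ineq4[of \<i> "of_real y"] by simp

section \<open>Nodes in a single dyadic block\<close>

lemma fmeasurable_Icc: "{a..b::real} \<in> fmeasurable lborel"
  by (simp add: fmeasurable_def emeasure_lborel_Icc_eq)

text \<open>
  The points are chosen greedily from left to right: each point, taken close to the infimum of what is left,
  uses up measure only slightly more than \<open>s\<close>, and the strict inequality on the measure pays for the excess.
\<close>

lemma ex_spaced_points:
  fixes K :: "real set"
  assumes "K \<in> sets borel" "K \<subseteq> {l..u}" "0 \<le> s" "real r * s < measure lborel K"
  shows "\<exists>x :: nat \<Rightarrow> real. (\<forall>a\<le>r. x a \<in> K) \<and> (\<forall>a<r. x a + s \<le> x (Suc a))"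
  using assms
proof (induction r arbitrary: K)
  case 0
  hence "K \<noteq> {}" by auto
  then obtain y where "y \<in> K" by auto
  thus ?case by (intro exI[of _ "\<lambda>_. y"]) auto
next
  case (Suc r)
  define \<delta> where "\<delta> = measure lborel K - real (Suc r) * s"
  have \<delta>: "\<delta> > 0" using Suc.prems by (simp add: \<delta>_def)
  have "0 \<le> real (Suc r) * s" using Suc.prems by simp
  hence ne: "K \<noteq> {}" using Suc.prems(4) by auto
  have bdd: "bdd_below K" using Suc.prems(2) by (meson bdd_below_Icc bdd_below_mono)
  obtain y where y: "y \<in> K" "y < Inf K + \<delta>"
    using cInf_lessD[OF ne, of "Inf K + \<delta>"] \<delta> by auto
  have Inf_y: "Inf K \<le> y" using y bdd by (simp add: cInf_lower)
  define K' where "K' = K \<inter> {y + s..}"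
  have K': "K' \<in> sets borel" "K' \<subseteq> {l..u}" using Suc.prems by (auto simp: K'_def)
  have "K \<subseteq> K' \<union> {Inf K..y + s}"
    using bdd by (auto simp: K'_def cInf_lower)
  moreover have "K' \<union> {Inf K..y + s} \<in> fmeasurable lborel"
    using K' by (intro fmeasurable.Un fmeasurableI2[OF fmeasurable_Icc K'(2)] fmeasurable_Icc) auto
  ultimately have "measure lborel K \<le> measure lborel (K' \<union> {Inf K..y + s})"
    using Suc.prems by (intro measure_mono_fmeasurable) auto
  also have "\<dots> \<le> measure lborel K' + measure lborel {Inf K..y + s}"
    using K' by (intro measure_Un_le) auto
  also have "measure lborel {Inf K..y + s} = y + s - Inf K"
    using Inf_y Suc.prems by simp
  finally have "real r * s < measure lborel K'"
    using y(2) by (simp add: \<delta>_def algebra_simps)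
  from Suc.IH[OF K' Suc.prems(3) this] obtain x where
    x: "\<And>a. a \<le> r \<Longrightarrow> x a \<in> K'" "\<And>a. a < r \<Longrightarrow> x a + s \<le> x (Suc a)" by blast
  show ?case
  proof (intro exI[of _ "case_nat y x"] conjI allI impI)
    fix a assume "a \<le> Suc r"
    thus "case_nat y x a \<in> K" using y x(1) by (cases a) (auto simp: K'_def)
  next
    fix a assume "a < Suc r"
    thus "case_nat y x a + s \<le> case_nat y x (Suc a)"
      using x(1)[of 0] x(2) by (cases a) (auto simp: K'_def)
  qed
qed

lemma spaced_points_dist:
  fixes x :: "nat \<Rightarrow> real"
  assumes step: "\<And>a. a < r \<Longrightarrow> x a + s \<le> x (Suc a)" and "a \<le> b" "b \<le> r"
  shows "s * (real b - real a) \<le> x b - x a"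
  using \<open>a \<le> b\<close> \<open>b \<le> r\<close>
proof (induction b rule: dec_induct)
  case (step b)
  thus ?case using assms(1)[of b] by (simp add: algebra_simps)
qed simp

lemma prod_index_distances:
  assumes "a \<le> r"
  shows "(\<Prod>b\<in>{..r} - {a}. \<bar>real a - real b\<bar>) = fact a * fact (r - a)"
  using assms
proof (induction r rule: dec_induct)
  case base
  have "{..a} - {a} = {0..<a}" by auto
  hence "(\<Prod>b\<in>{..a} - {a}. \<bar>real a - real b\<bar>) = (\<Prod>b\<in>{0..<a}. real (a - b))"
    by (auto intro!: prod.cong simp: of_nat_diff)
  also have "\<dots> = fact a" by (simp add: fact_prod_rev)
  finally show ?case by simp
next
  case (step r)
  have "{..Suc r} - {a} = insert (Suc r) ({..r} - {a})" using step by auto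
  thus ?case using step by (simp add: Suc_diff_le)
qed

lemma fact_le_split:
  assumes "a \<le> (r::nat)"
  shows "fact r / 2 ^ r \<le> (fact a * fact (r - a) :: real)"
proof -
  have "(fact r :: real) = fact a * fact (r - a) * real (r choose a)"
    using binomial_fact[OF assms, where 'a = real] by (simp add: field_simps)
  also have "real (r choose a) \<le> 2 ^ r"
    using of_nat_mono[OF binomial_le_pow2[of r a], where 'a = real] by simp
  finally show ?thesis by (simp add: divide_simps mult_left_mono)
qed

lemma power_div_fact_le_exp:
  assumes "0 \<le> (x::real)"
  shows "x ^ r / fact r \<le> exp x"
proof -
  have "(\<Sum>k\<in>{r}. x ^ k /\<^sub>R fact k) \<le> (\<Sum>k. x ^ k /\<^sub>R fact k)"
    using assms summable_exp_generic[of x] by (intro sum_le_suminf) auto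
  thus ?thesis by (simp add: exp_def divide_inverse mult.commute)
qed

text \<open>
  Points of \<open>K\<close> with gaps proportional to \<open>1 / (R r)\<close> are spread evenly enough: the product of the
  distances from one of them to the others is at least of order \<open>(r-1)! / (2 R r)\<^bsup>r-1\<^esup>\<close>, so the
  powers of \<open>r\<close> cancel and each node costs a factor of order \<open>R\<^sup>2\<close> only.
\<close>

lemma ex_nodes_in_block:
  fixes K :: "real set"
  assumes K: "K \<in> sets borel" "K \<subseteq> {R..2 * R}" and R: "1 \<le> R" and meas: "1 / R < measure lborel K"
  shows "\<exists>Y. good_nodes K r ((18 * R\<^sup>2) ^ r) Y"
proof (cases r)
  case 0
  thus ?thesis by (intro exI[of _ "{}"]) (auto simp: good_nodes_def)
next
  case (Suc k)
  define s where "s = 1 / (R * real (Suc k))"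
  have s: "s > 0" using R by (simp add: s_def)
  have "real k * s \<le> 1 / R"
    using mult_left_le_one_le[of "1 / R" "real k / real (Suc k)"] R by (simp add: s_def mult.commute)
  hence "real k * s < measure lborel K" using meas by simp
  from ex_spaced_points[OF K less_imp_le[OF s] this] obtain x where
    x: "\<And>a. a \<le> k \<Longrightarrow> x a \<in> K" "\<And>a. a < k \<Longrightarrow> x a + s \<le> x (Suc a)" by blast
  have dist: "s * \<bar>real a - real b\<bar> \<le> \<bar>x a - x b\<bar>" if "a \<le> k" "b \<le> k" for a b
    using spaced_points_dist[of k x s a b] spaced_points_dist[of k x s b a] x(2) that
    by (cases "a \<le> b") auto
  have inj: "inj_on x {..k}"
  proof (rule inj_onI)
    fix a b assume "a \<in> {..k}" "b \<in> {..k}" "x a = x b"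
    hence "s * \<bar>real a - real b\<bar> \<le> 0" using dist[of a b] by simp
    thus "a = b" using s by (simp add: mult_le_0_iff)
  qed
  have "node_factor (x ` {..k}) (x a) \<le> (18 * R\<^sup>2) ^ r" if a: "a \<le> k" for a
  proof -
    have "x ` {..k} - {x a} = x ` ({..k} - {a})"
      using inj a by (auto simp: inj_on_def)
    hence "node_factor (x ` {..k}) (x a) = (\<Prod>b\<in>{..k} - {a}. cmod (\<i> - of_real (x b)) / \<bar>x a - x b\<bar>)"
      unfolding node_factor_def
      by (simp add: prod.reindex[OF inj_on_subset[OF inj Diff_subset]])
    also have "\<dots> \<le> (\<Prod>b\<in>{..k} - {a}. (3 * R / s) / \<bar>real a - real b\<bar>)"
    proof (intro prod_mono conjI)
      fix b assume b: "b \<in> {..k} - {a}"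
      have xb: "R \<le> x b" "x b \<le> 2 * R" using x(1)[of b] b K(2) by auto
      have "cmod (\<i> - of_real (x b)) \<le> 3 * R"
        using cmod_i_minus_le[of "x b"] xb R by linarith
      moreover have "0 < \<bar>real a - real b\<bar>" using b by auto
      ultimately have "cmod (\<i> - of_real (x b)) / \<bar>x a - x b\<bar> \<le> 3 * R / (s * \<bar>real a - real b\<bar>)"
        using dist[of a b] a b s R by (intro frac_le) auto
      thus "cmod (\<i> - of_real (x b)) / \<bar>x a - x b\<bar> \<le> 3 * R / s / \<bar>real a - real b\<bar>"
        by simp
    qed auto
    also have "\<dots> = (3 * R / s) ^ k / (fact a * fact (k - a))"
    proof -
      have "card ({..k} - {a}) = k" using a by simp
      thus ?thesis unfolding prod_dividef prod_index_distances[OF a] prod_constant by (simp only: power_divide)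
    qed
    also have "\<dots> \<le> (3 * R / s) ^ k / (fact k / 2 ^ k)"
      using fact_le_split[OF a] R s by (intro divide_left_mono) auto
    also have "\<dots> = (6 * R\<^sup>2) ^ k * (real (Suc k) ^ k / fact k)"
      using R by (simp add: s_def power2_eq_square power_mult_distrib[symmetric] mult_ac del: of_nat_Suc)
    also have "\<dots> \<le> (6 * R\<^sup>2) ^ k * exp (real (Suc k))"
      by (intro mult_left_mono power_div_fact_le_exp) auto
    also have "exp (real (Suc k)) = exp 1 ^ Suc k"
      by (metis exp_of_nat_mult mult.right_neutral)
    also have "(6 * R\<^sup>2) ^ k * exp 1 ^ Suc k \<le> (6 * R\<^sup>2) ^ Suc k * 3 ^ Suc k"
    proof (intro mult_mono power_mono exp_le)
      have "1 \<le> 6 * R\<^sup>2" using one_le_power[OF R, of 2] by linarith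
      thus "(6 * R\<^sup>2) ^ k \<le> (6 * R\<^sup>2) ^ Suc k" by (intro power_increasing le_SucI order.refl)
    qed auto
    also have "\<dots> = (18 * R\<^sup>2) ^ r"
    proof -
      have "6 * R\<^sup>2 * 3 = 18 * R\<^sup>2" by simp
      thus ?thesis by (simp only: Suc power_mult_distrib[symmetric])
    qed
    finally show ?thesis .
  qed
  hence "\<forall>y\<in>x ` {..k}. node_factor (x ` {..k}) y \<le> (18 * R\<^sup>2) ^ r" by blast
  moreover have "card (x ` {..k}) = r" by (simp add: card_image[OF inj] Suc)
  moreover have "x ` {..k} \<subseteq> K" using x(1) by blast
  moreover have "finite (x ` {..k})" by simp
  ultimately show ?thesis
    unfolding good_nodes_def by (intro exI[of _ "x ` {..k}"] conjI)
qed

section \<open>Nodes in a set of infinite measure\<close>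

text \<open>
  The bounds \<open>1 / R\<close> are summable over dyadic \<open>R\<close>, so infinitely many dyadic blocks must exceed
  them. Measure \<open>1 / R\<close> suffices because the cost of a node in the block is then polynomial in \<open>R\<close>.
\<close>

lemma ex_block_of_large_measure:
  fixes F :: "nat \<Rightarrow> real set"
  assumes F: "\<And>n. F n \<in> sets borel" "incseq F" and nonneg: "\<And>n. F n \<subseteq> {0..}"
    and inf: "emeasure lborel (\<Union>n. F n) = \<infinity>"
  shows "\<exists>R\<ge>B. \<exists>C. 1 / R < measure lborel (F C \<inter> {R..2 * R})"
proof (rule ccontr)
  assume neg: "\<not> ?thesis"
  define S where "S = (\<Union>n. F n)"
  have S: "S \<in> sets borel" using F by (auto simp: S_def)
  obtain j0 :: nat where j0: "B < 2 ^ j0" using real_arch_pow[of 2 B] by auto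
  define I where "I j = {2 ^ (j0 + j)..2 * 2 ^ (j0 + j) :: real}" for j
  have small: "emeasure lborel (S \<inter> I j) \<le> ennreal ((1 / 2) ^ j)" for j
  proof -
    define R :: real where "R = 2 ^ (j0 + j)"
    have R: "R \<ge> 2 ^ j0" "R \<ge> 2 ^ j" by (auto simp: R_def intro!: power_increasing)
    hence "R > B" "R > 0" using j0 zero_less_power[of "2::real" j0] by linarith+
    hence "measure lborel (F C \<inter> {R..2 * R}) \<le> 1 / R" for C
      using neg by (auto simp: not_less)
    also have "1 / R \<le> (1 / 2) ^ j"
      using R(2) by (simp add: power_one_over frac_le)
    finally have *: "measure lborel (F C \<inter> {R..2 * R}) \<le> (1 / 2) ^ j" for C by simp
    have "emeasure lborel (F C \<inter> {R..2 * R}) \<le> ennreal ((1 / 2) ^ j)" for C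
    proof -
      have "F C \<inter> {R..2 * R} \<in> fmeasurable lborel"
        using F by (intro fmeasurableI2[OF fmeasurable_Icc[of R "2 * R"]]) auto
      thus ?thesis using * by (simp add: emeasure_eq_measure2 ennreal_leI)
    qed
    hence "(SUP C. emeasure lborel (F C \<inter> {R..2 * R})) \<le> ennreal ((1 / 2) ^ j)"
      by (intro SUP_least)
    moreover have "(SUP C. emeasure lborel (F C \<inter> {R..2 * R})) = emeasure lborel (\<Union>C. F C \<inter> {R..2 * R})"
      using F by (intro SUP_emeasure_incseq) (auto simp: incseq_def)
    moreover have "(\<Union>C. F C \<inter> {R..2 * R}) = S \<inter> I j"
      by (auto simp: S_def I_def R_def)
    ultimately show ?thesis by simp
  qed
  have cover: "S \<subseteq> {0..2 ^ j0} \<union> (\<Union>j. S \<inter> I j)"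
  proof
    fix x assume x: "x \<in> S"
    hence "0 \<le> x" using nonneg by (auto simp: S_def)
    show "x \<in> {0..2 ^ j0} \<union> (\<Union>j. S \<inter> I j)"
    proof (cases "x \<le> 2 ^ j0")
      case False
      define j where "j = (LEAST j. x \<le> 2 ^ (j0 + Suc j))"
      obtain n where "x < 2 ^ n" using real_arch_pow[of 2 x] by auto
      moreover have "(2::real) ^ n \<le> 2 ^ (j0 + Suc n)" by (intro power_increasing) auto
      ultimately have "x \<le> 2 ^ (j0 + Suc n)" by linarith
      hence 1: "x \<le> 2 ^ (j0 + Suc j)" unfolding j_def by (rule LeastI)
      have 2: "2 ^ (j0 + j) < x"
      proof (cases j)
        case 0
        thus ?thesis using False by simp
      next
        case (Suc i)
        hence "\<not> x \<le> 2 ^ (j0 + Suc i)" unfolding j_def by (intro not_less_Least) auto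
        thus ?thesis using Suc by simp
      qed
      have "x \<in> I j" using 1 2 by (simp add: I_def)
      thus ?thesis using x by auto
    qed (use \<open>0 \<le> x\<close> in auto)
  qed
  have sets: "S \<inter> I j \<in> sets lborel" for j using S by (auto simp: I_def)
  have "emeasure lborel S \<le> emeasure lborel ({0..2 ^ j0} \<union> (\<Union>j. S \<inter> I j))"
    using sets by (intro emeasure_mono cover sets.Un sets.countable_UN) auto
  also have "\<dots> \<le> emeasure lborel {0..2 ^ j0 :: real} + emeasure lborel (\<Union>j. S \<inter> I j)"
    using sets by (intro emeasure_subadditive sets.countable_UN) auto
  also have "\<dots> \<le> ennreal (2 ^ j0) + (\<Sum>j. emeasure lborel (S \<inter> I j))"
    using sets by (intro add_mono emeasure_subadditive_countably) auto
  also have "(\<Sum>j. emeasure lborel (S \<inter> I j)) \<le> (\<Sum>j. ennreal ((1 / 2) ^ j))"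
    by (intro suminf_le small) auto
  also have "\<dots> = ennreal (\<Sum>j. (1 / 2) ^ j)"
    by (intro suminf_ennreal2) (auto intro: summable_geometric)
  also have "ennreal (2 ^ j0) + \<dots> < \<infinity>" by simp
  finally show False using inf by (simp add: S_def)
qed

text \<open>
  The constants \<open>A\<close>, \<open>T\<close> and \<open>C\<close> precede \<open>n\<close>: a new block of nodes is placed far beyond \<open>T\<close>, and its
  position may not depend on the number of nodes.
\<close>

definition node_rate :: "(nat \<Rightarrow> real set) \<Rightarrow> real \<Rightarrow> bool" where
  "node_rate F \<kappa> \<longleftrightarrow> (\<exists>A T C. \<forall>n. \<exists>X. good_nodes (F C \<inter> {..T}) n (A * exp (\<kappa> * n)) X)"

text \<open>
  Take about \<open>4n/5\<close> of the nodes by the old rule and the remaining \<open>r \<le> n/5\<close> in a remote block \<open>[R, 2R]\<close>. For an old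
  node the exponent drops to \<open>4\<kappa>n/5\<close>, and the new nodes contribute factors close to \<open>1\<close>, since
  a remote point is at nearly the same distance from \<open>\<i>\<close> and from every old node. For a new node, its
  neighbours in the block cost at most \<open>(18 R\<^sup>2)\<^sup>r\<close>, but each of the at least \<open>4r\<close> old nodes contributes a
  factor of order \<open>1 / R\<close>, and \<open>R\<^sup>2 R\<^bsup>-4\<^esup>\<close> is small.
\<close>

lemma node_rate_improve:
  fixes F :: "nat \<Rightarrow> real set"
  assumes F: "\<And>n. F n \<in> sets borel" "incseq F" and nonneg: "\<And>n. F n \<subseteq> {0..}"
    and inf: "emeasure lborel (\<Union>n. F n) = \<infinity>"
    and \<kappa>: "0 < \<kappa>" and rate: "node_rate F \<kappa>"
  shows "node_rate F (9 / 10 * \<kappa>)"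
proof -
  from rate obtain A0 T0 C0 where 0: "\<forall>n. \<exists>X. good_nodes (F C0 \<inter> {..T0}) n (A0 * exp (\<kappa> * n)) X"
    unfolding node_rate_def by blast
  define A T where "A = max 1 A0" and "T = max 0 T0"
  have AT: "1 \<le> A" "A0 \<le> A" "0 \<le> T" "T0 \<le> T" by (auto simp: A_def T_def)
  \<comment> \<open>The factor that a new node may contribute at an old one is \<open>e\<^bsup>\<eta>\<^esup>\<close>, so that the exponent becomes \<open>4\<kappa>/5 + \<eta>\<close> at most.\<close>
  define \<eta> where "\<eta> = \<kappa> / 10"
  have \<eta>: "\<eta> > 0" using \<kappa> by (simp add: \<eta>_def)
  \<comment> \<open>The first bound makes \<open>18 R\<^sup>2 (2 (T + 1) / R)\<^sup>4 \<le> 1\<close>, the second one \<open>(T + 1) / (R - T) \<le> \<eta>\<close>.\<close>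
  obtain R C1 where R: "R \<ge> max (17 * (T + 1)\<^sup>2) (T + (T + 1) / \<eta>)"
    and C1: "1 / R < measure lborel (F C1 \<inter> {R..2 * R})"
    using ex_block_of_large_measure[OF F nonneg inf] by blast
  have R1: "17 * (T + 1)\<^sup>2 \<le> R" and R2: "T + (T + 1) / \<eta> \<le> R" using R by auto
  have "T + 1 \<le> (T + 1)\<^sup>2" using AT(3) by (simp add: power2_eq_square algebra_simps)
  hence R3: "17 * (T + 1) \<le> R" using R1 by simp
  hence R4: "1 \<le> R" "T < R" "R \<le> 2 * (R - T)" using AT(3) by auto
  define K where "K = F C1 \<inter> {R..2 * R}"
  have K: "K \<in> sets borel" "K \<subseteq> {R..2 * R}" "1 / R < measure lborel K"
    using F C1 by (auto simp: K_def)
  define C where "C = max C0 C1"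
  have FC: "F C0 \<subseteq> F C" "F C1 \<subseteq> F C" using F(2) by (auto simp: C_def incseq_def)
  have "\<exists>Z. good_nodes (F C \<inter> {..2 * R}) n ((A * exp \<kappa>) * exp (9 / 10 * \<kappa> * n)) Z" for n
  proof -
    define r where "r = n div 5"
    define k where "k = n - r"
    have rk: "n = k + r" "4 * r \<le> k" "5 * k \<le> 4 * n + 5"
      by (auto simp: r_def k_def)
    obtain X where "good_nodes (F C0 \<inter> {..T0}) k (A0 * exp (\<kappa> * k)) X"
      using 0 by blast
    hence X: "finite X" "X \<subseteq> F C0 \<inter> {..T0}" "card X = k"
      "\<And>x. x \<in> X \<Longrightarrow> node_factor X x \<le> A0 * exp (\<kappa> * k)"
      unfolding good_nodes_def by simp_all
    obtain Y where "good_nodes K r ((18 * R\<^sup>2) ^ r) Y"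
      using ex_nodes_in_block[OF K(1,2) R4(1) K(3)] by blast
    hence Y: "finite Y" "Y \<subseteq> K" "card Y = r"
      "\<And>y. y \<in> Y \<Longrightarrow> node_factor Y y \<le> (18 * R\<^sup>2) ^ r"
      unfolding good_nodes_def by simp_all
    have Xb: "0 \<le> x" "x \<le> T" if "x \<in> X" for x using that X(2) nonneg[of C0] AT(4) by auto
    have Yb: "R \<le> y" "y \<le> 2 * R" if "y \<in> Y" for y using that Y(2) K(2) by auto
    have disj: "X \<inter> Y = {}" using Xb Yb R4 by (meson disjoint_iff le_less_trans not_le)
    have old: "node_factor (X \<union> Y) x \<le> A * exp \<kappa> * exp (9 / 10 * \<kappa> * n)" if x: "x \<in> X" for x
    proof -
      have "cmod (\<i> - of_real y) / \<bar>x - y\<bar> \<le> exp \<eta>" if y: "y \<in> Y" for y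
      proof -
        note b = Xb[OF x] Yb[OF y]
        have pos: "0 < y - T" using b R4 by linarith
        have "cmod (\<i> - of_real y) / \<bar>x - y\<bar> \<le> (1 + y) / (y - T)"
          using cmod_i_minus_le[of y] b R4 by (intro frac_le) auto
        also have "\<dots> = 1 + (T + 1) / (y - T)"
          using pos by (simp add: field_simps)
        also have "(T + 1) / (y - T) \<le> (T + 1) / (R - T)"
          using b R4 AT(3) by (intro frac_le) auto
        also have "\<dots> \<le> \<eta>"
        proof -
          have "(T + 1) / \<eta> \<le> R - T" using R2 by simp
          thus ?thesis using R4 \<eta> by (simp add: pos_divide_le_eq mult.commute)
        qed
        also have "1 + \<eta> \<le> exp \<eta>" by (rule exp_ge_add_one_self)
        finally show ?thesis by simp
      qed
      hence "(\<Prod>y\<in>Y. cmod (\<i> - of_real y) / \<bar>x - y\<bar>) \<le> exp \<eta> ^ r"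
        using \<eta> Y(3) by (intro prod_le_power) auto
      moreover have "node_factor X x \<le> A * exp (\<kappa> * k)"
        by (rule order.trans[OF X(4)[OF x] mult_right_mono[OF AT(2)]]) simp
      ultimately have "node_factor (X \<union> Y) x \<le> A * exp (\<kappa> * k) * exp \<eta> ^ r"
        unfolding node_factor_Un[OF X(1) Y(1) disj x] using AT(1)
        by (intro mult_mono prod_nonneg) (auto intro!: prod_nonneg)
      also have "\<dots> = A * exp (\<kappa> * k + \<eta> * r)"
        by (simp only: exp_add exp_of_nat2_mult mult.assoc)
      also have "\<dots> \<le> A * exp (\<kappa> + 9 / 10 * \<kappa> * n)"
      proof -
        have "real k + real r / 10 \<le> 1 + 9 / 10 * real n"
        proof -
          have "real (5 * k) \<le> real (4 * n + 5)" using rk(3) by (rule of_nat_mono)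
          moreover have "real r \<le> real n" using rk(1) by simp
          ultimately show ?thesis by simp
        qed
        hence "\<kappa> * (real k + real r / 10) \<le> \<kappa> * (1 + 9 / 10 * real n)"
          using \<kappa> by (intro mult_left_mono) auto
        thus ?thesis using AT(1) by (simp add: \<eta>_def algebra_simps)
      qed
      finally show ?thesis by (simp add: exp_add mult_ac)
    qed
    have new: "node_factor (X \<union> Y) y \<le> A * exp \<kappa> * exp (9 / 10 * \<kappa> * n)" if y: "y \<in> Y" for y
    proof -
      define q where "q = 2 * (T + 1) / R"
      have q: "0 \<le> q" "q \<le> 1" using R3 R4 AT(3) by (auto simp: q_def)
      have "cmod (\<i> - of_real x) / \<bar>y - x\<bar> \<le> q" if x: "x \<in> X" for x
      proof -
        note b = Xb[OF x] Yb[OF y]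
        have "cmod (\<i> - of_real x) / \<bar>y - x\<bar> \<le> (T + 1) / (R / 2)"
          using cmod_i_minus_le[of x] b R4 AT(3) by (intro frac_le) auto
        thus ?thesis by (simp add: q_def mult.commute)
      qed
      hence "(\<Prod>x\<in>X. cmod (\<i> - of_real x) / \<bar>y - x\<bar>) \<le> (\<Prod>x\<in>X. q)"
        by (intro prod_mono) auto
      also have "\<dots> = q ^ k" using X(3) by simp
      also have "\<dots> \<le> q ^ (4 * r)" using q rk(2) by (intro power_decreasing)
      finally have "node_factor (Y \<union> X) y \<le> (18 * R\<^sup>2) ^ r * q ^ (4 * r)"
        unfolding node_factor_Un[OF Y(1) X(1) disj[unfolded Int_commute[of X]] y]
        by (intro mult_mono[OF Y(4)[OF y]] prod_nonneg) auto
      also have "\<dots> = (18 * R\<^sup>2 * q ^ 4) ^ r"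
        by (simp add: power_mult power_mult_distrib)
      also have "\<dots> \<le> 1"
      proof (rule power_le_one)
        have "(17 * (T + 1)\<^sup>2)\<^sup>2 \<le> R\<^sup>2" using R1 by (intro power_mono) auto
        hence "289 * (T + 1) ^ 4 \<le> R\<^sup>2" by (simp add: power_mult_distrib flip: power_mult)
        moreover have "0 \<le> (T + 1) ^ 4" using AT(3) by simp
        ultimately have "288 * (T + 1) ^ 4 \<le> R\<^sup>2" by linarith
        moreover have "18 * R\<^sup>2 * q ^ 4 = 288 * (T + 1) ^ 4 / R\<^sup>2"
        proof -
          have "18 * R\<^sup>2 * (2 * u / R) ^ 4 = 288 * u ^ 4 / R\<^sup>2" for u
            using R4(1) by (simp add: power_divide power_mult_distrib power4_eq_xxxx power2_eq_square)
          thus ?thesis by (simp only: q_def)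
        qed
        ultimately show "18 * R\<^sup>2 * q ^ 4 \<le> 1" using R4 by simp
      qed (use q in auto)
      also have "1 \<le> A * exp \<kappa> * exp (9 / 10 * \<kappa> * n)"
      proof -
        have "1 \<le> exp \<kappa>" "1 \<le> exp (9 / 10 * \<kappa> * n)" using \<kappa> by auto
        hence "1 \<le> A * exp \<kappa>" using AT(1) mult_mono[of 1 A 1 "exp \<kappa>"] by simp
        thus ?thesis using \<open>1 \<le> exp (9 / 10 * \<kappa> * n)\<close> mult_mono[of 1 "A * exp \<kappa>" 1 "exp (9 / 10 * \<kappa> * n)"]
          by simp
      qed
      finally show ?thesis by (simp add: Un_commute)
    qed
    have "card (X \<union> Y) = n" using X Y disj rk(1) by (simp add: card_Un_disjoint)
    moreover have "X \<union> Y \<subseteq> F C \<inter> {..2 * R}"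
    proof
      fix z assume "z \<in> X \<union> Y"
      thus "z \<in> F C \<inter> {..2 * R}"
      proof
        assume "z \<in> X"
        thus ?thesis using X(2) FC(1) Xb(2)[of z] R4 by auto
      next
        assume "z \<in> Y"
        thus ?thesis using Y(2) FC(2) Yb(2)[of z] by (auto simp: K_def)
      qed
    qed
    ultimately show ?thesis
      using X(1) Y(1) old new unfolding good_nodes_def by (intro exI[of _ "X \<union> Y"]) auto
  qed
  thus ?thesis unfolding node_rate_def by blast
qed

lemma node_rate_all:
  fixes F :: "nat \<Rightarrow> real set"
  assumes F: "\<And>n. F n \<in> sets borel" "incseq F" and nonneg: "\<And>n. F n \<subseteq> {0..}"
    and inf: "emeasure lborel (\<Union>n. F n) = \<infinity>" and \<kappa>: "0 < \<kappa>"
  shows "\<exists>A C. \<forall>n. \<exists>X. good_nodes (F C) n (A * exp (\<kappa> * n)) X"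
proof -
  obtain R C where R: "1 \<le> R" and C: "1 / R < measure lborel (F C \<inter> {R..2 * R})"
    using ex_block_of_large_measure[OF F nonneg inf] by blast
  define \<kappa>0 where "\<kappa>0 = ln (18 * R\<^sup>2)"
  have R2: "1 \<le> R\<^sup>2" using R by simp
  hence "1 < 18 * R\<^sup>2" by linarith
  hence \<kappa>0: "0 < \<kappa>0" "exp \<kappa>0 = 18 * R\<^sup>2" using R unfolding \<kappa>0_def by (intro ln_gt_zero exp_ln; simp)+
  have base: "node_rate F \<kappa>0"
    unfolding node_rate_def
  proof (rule exI[of _ 1], rule exI[of _ "2 * R"], rule exI[of _ C], rule allI)
    fix n
    obtain Y where "good_nodes (F C \<inter> {R..2 * R}) n ((18 * R\<^sup>2) ^ n) Y"
      using ex_nodes_in_block[of "F C \<inter> {R..2 * R}" R n] F R C by auto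
    moreover have "(18 * R\<^sup>2) ^ n = 1 * exp (\<kappa>0 * n)"
      by (simp only: exp_of_nat2_mult \<kappa>0(2) mult_1_left)
    ultimately have "good_nodes (F C \<inter> {..2 * R}) n (1 * exp (\<kappa>0 * n)) Y"
      unfolding good_nodes_def by auto
    thus "\<exists>X. good_nodes (F C \<inter> {..2 * R}) n (1 * exp (\<kappa>0 * n)) X" ..
  qed
  have iter: "node_rate F ((9 / 10) ^ m * \<kappa>0)" for m
  proof (induction m)
    case (Suc m)
    show ?case using node_rate_improve[OF F nonneg inf _ Suc] \<kappa>0 by (simp add: mult_ac)
  qed (use base in simp)
  obtain m where "(9 / 10 :: real) ^ m < \<kappa> / \<kappa>0"
    using real_arch_pow_inv[of "\<kappa> / \<kappa>0" "9 / 10"] \<kappa> \<kappa>0 by auto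
  hence m: "(9 / 10) ^ m * \<kappa>0 \<le> \<kappa>" using \<kappa>0 by (simp add: field_simps)
  from iter[of m] obtain A T C where
    *: "\<forall>n. \<exists>X. good_nodes (F C \<inter> {..T}) n (A * exp ((9 / 10) ^ m * \<kappa>0 * n)) X"
    unfolding node_rate_def by blast
  have "\<exists>X. good_nodes (F C) n (max 0 A * exp (\<kappa> * n)) X" for n
  proof -
    obtain X where X: "good_nodes (F C \<inter> {..T}) n (A * exp ((9 / 10) ^ m * \<kappa>0 * n)) X"
      using * by blast
    have "A * exp ((9 / 10) ^ m * \<kappa>0 * n) \<le> max 0 A * exp (\<kappa> * n)"
      using m by (intro mult_mono) (auto intro!: mult_right_mono)
    hence "good_nodes (F C) n (max 0 A * exp (\<kappa> * n)) X"
      using X unfolding good_nodes_def by force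
    thus ?thesis ..
  qed
  thus ?thesis by blast
qed

section \<open>The recurrence\<close>

text \<open>
  The coefficients are elements of an arbitrary commutative ring so that real solutions, complex solutions and
  the polynomials in the parameter, with coefficients \<open>[:2, c k:]\<close>, are instances of one recurrence.
\<close>

fun three_term :: "(nat \<Rightarrow> 'a::comm_ring_1) \<Rightarrow> 'a \<Rightarrow> 'a \<Rightarrow> nat \<Rightarrow> 'a" where
  "three_term b u v 0 = u"
| "three_term b u v (Suc 0) = v"
| "three_term b u v (Suc (Suc n)) = b (Suc n) * three_term b u v (Suc n) - three_term b u v n"

lemma three_term_linear:
  "three_term b u v n = u * three_term b 1 0 n + v * three_term b 0 1 n"
  by (induction b u v n rule: three_term.induct) (auto simp: algebra_simps)

lemma three_term_wronskian:
  "three_term b 1 0 n * three_term b 0 1 (Suc n) - three_term b 1 0 (Suc n) * three_term b 0 1 n = 1"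
proof (induction n)
  case (Suc n)
  thus ?case by (simp add: algebra_simps)
qed simp

lemma poly_three_term:
  "poly (three_term B p q n) z = three_term (\<lambda>k. poly (B k) z) (poly p z) (poly q z) n"
  by (induction B p q n rule: three_term.induct) auto

lemma three_term_of_real:
  "three_term (\<lambda>k. of_real (b k)) (of_real u) (of_real v) n
     = (of_real (three_term b u v n) :: 'a::{real_algebra_1,comm_ring_1})"
  by (induction b u v n rule: three_term.induct) auto

lemma degree_three_term:
  assumes "\<And>k. degree (B k) \<le> 1"
  shows "degree (three_term B 0 1 (Suc n)) \<le> n"
proof -
  have "degree (three_term B 0 1 n) \<le> n - 1 \<and> degree (three_term B 0 1 (Suc n)) \<le> n"
  proof (induction n)
    case (Suc n)
    have "degree (B (Suc n) * three_term B 0 1 (Suc n)) \<le> Suc n"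
      using degree_mult_le[of "B (Suc n)" "three_term B 0 1 (Suc n)"] assms[of "Suc n"] Suc by linarith
    thus ?case using Suc by (auto intro!: degree_diff_le)
  qed simp
  thus ?thesis by simp
qed

lemma is_solution_iff_three_term:
  "is_solution c t q \<longleftrightarrow> (\<exists>u v. q = three_term (\<lambda>k. 2 + t * c k) u v)"
proof
  assume sol: "is_solution c t q"
  define w where "w = three_term (\<lambda>k. 2 + t * c k) (q 0) (q 1)"
  have "q n = w n \<and> q (Suc n) = w (Suc n)" for n
  proof (induction n)
    case (Suc n)
    have "q (Suc n + 1) - (2 + t * c (Suc n)) * q (Suc n) + q (Suc n - 1) = 0"
      using sol unfolding is_solution_def by auto
    thus ?case using Suc by (simp add: w_def)
  qed (simp add: w_def)
  hence "q = w" by auto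
  thus "\<exists>u v. q = three_term (\<lambda>k. 2 + t * c k) u v" unfolding w_def by blast
next
  assume "\<exists>u v. q = three_term (\<lambda>k. 2 + t * c k) u v"
  then obtain u v where q: "q = three_term (\<lambda>k. 2 + t * c k) u v" by blast
  show "is_solution c t q"
    unfolding is_solution_def
  proof (intro allI impI)
    fix k :: nat assume "k \<ge> 1"
    then obtain m where "k = Suc m" by (cases k) auto
    thus "q (k + 1) - (2 + t * c k) * q k + q (k - 1) = 0" by (simp add: q)
  qed
qed

lemma stable_parameters_alt:
  "stable_parameters c = {0..} \<inter> {t. bounded (range (three_term (\<lambda>k. 2 + t * c k) 1 0))}
     \<inter> {t. bounded (range (three_term (\<lambda>k. 2 + t * c k) 0 1))}"
proof -
  have "(\<forall>q. is_solution c t q \<longrightarrow> bounded (range q)) \<longleftrightarrow>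
      bounded (range (three_term (\<lambda>k. 2 + t * c k) 1 0)) \<and>
      bounded (range (three_term (\<lambda>k. 2 + t * c k) 0 1))" (is "?all \<longleftrightarrow> bounded (range ?p) \<and> bounded (range ?q)") for t
  proof
    assume ?all
    thus "bounded (range ?p) \<and> bounded (range ?q)"
      unfolding is_solution_iff_three_term by blast
  next
    assume bdd: "bounded (range ?p) \<and> bounded (range ?q)"
    then obtain M N where M: "\<And>n. \<bar>?p n\<bar> \<le> M" and N: "\<And>n. \<bar>?q n\<bar> \<le> N"
      unfolding bounded_iff by auto
    show ?all
    proof (intro allI impI)
      fix w assume "is_solution c t w"
      then obtain u v where w: "w = three_term (\<lambda>k. 2 + t * c k) u v"
        unfolding is_solution_iff_three_term by blast
      have "\<bar>w n\<bar> \<le> \<bar>u\<bar> * M + \<bar>v\<bar> * N" for n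
      proof -
        have "\<bar>w n\<bar> \<le> \<bar>u * ?p n\<bar> + \<bar>v * ?q n\<bar>"
          unfolding w by (subst three_term_linear) (rule abs_triangle_ineq)
        also have "\<dots> \<le> \<bar>u\<bar> * M + \<bar>v\<bar> * N"
          unfolding abs_mult using M N by (intro add_mono mult_left_mono) auto
        finally show ?thesis .
      qed
      thus "bounded (range w)" unfolding bounded_iff by auto
    qed
  qed
  thus ?thesis by (auto simp: stable_parameters_def)
qed

lemma continuous_on_three_term:
  fixes c :: "nat \<Rightarrow> real"
  shows "continuous_on A (\<lambda>t. three_term (\<lambda>k. 2 + t * c k) u v n)"
proof -
  have "continuous_on A (\<lambda>t. three_term (\<lambda>k. 2 + t * c k) u v n) \<and>
        continuous_on A (\<lambda>t. three_term (\<lambda>k. 2 + t * c k) u v (Suc n))"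
    by (induction n) (auto intro!: continuous_intros)
  thus ?thesis ..
qed

lemma closed_uniformly_bounded_by:
  fixes f :: "nat \<Rightarrow> real \<Rightarrow> real"
  assumes "\<And>n. continuous_on UNIV (f n)"
  shows "closed {t. \<forall>n. \<bar>f n t\<bar> \<le> C}"
  using assms by (intro closed_Collect_all closed_Collect_le continuous_intros) auto

lemma sets_bounded_range:
  fixes f :: "nat \<Rightarrow> real \<Rightarrow> real"
  assumes "\<And>n. continuous_on UNIV (f n)"
  shows "{t. bounded (range (\<lambda>n. f n t))} \<in> sets borel"
proof -
  have "{t. bounded (range (\<lambda>n. f n t))} = (\<Union>C::nat. {t. \<forall>n. \<bar>f n t\<bar> \<le> real C})"
  proof (intro set_eqI iffI)
    fix t assume "t \<in> {t. bounded (range (\<lambda>n. f n t))}"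
    then obtain M where M: "\<And>n. \<bar>f n t\<bar> \<le> M" unfolding bounded_iff by auto
    obtain C :: nat where "M \<le> real C" using real_arch_simple by blast
    hence "\<And>n. \<bar>f n t\<bar> \<le> real C" using M order.trans by blast
    thus "t \<in> (\<Union>C::nat. {t. \<forall>n. \<bar>f n t\<bar> \<le> real C})" by blast
  qed (auto simp: bounded_iff)
  also have "\<dots> \<in> sets borel"
    using closed_uniformly_bounded_by[OF assms] by (intro sets.countable_UN) auto
  finally show ?thesis .
qed

section \<open>Bounded solutions force recurring coefficients\<close>

text \<open>
  Where \<open>e\<close> is small the solution is nearly affine, and a bounded function that is nearly affine on a long
  window has a small slope there.
\<close>

lemma slope_bound:
  fixes w :: "nat \<Rightarrow> real"
  assumes rec: "\<And>k. w (Suc (Suc k)) - 2 * w (Suc k) + w k = e (Suc k) * w (Suc k)"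
    and bound: "\<And>k. \<bar>w k\<bar> \<le> M"
    and small: "\<And>k. m < k \<Longrightarrow> k \<le> m + L \<Longrightarrow> \<bar>e k\<bar> \<le> \<delta>" and \<delta>: "0 \<le> \<delta>"
  shows "real L * \<bar>w (Suc m) - w m\<bar> \<le> 2 * M + real L * (real L * (\<delta> * M))"
proof -
  define d where "d = w (Suc m) - w m"
  have M: "0 \<le> \<delta> * M" using bound[of 0] \<delta> by (intro mult_nonneg_nonneg) linarith+
  have slope: "\<bar>w (Suc (m + i)) - w (m + i) - d\<bar> \<le> real i * (\<delta> * M)" if "i \<le> L" for i
    using that
  proof (induction i)
    case (Suc i)
    have "\<bar>e (Suc (m + i)) * w (Suc (m + i))\<bar> \<le> \<delta> * M"
      unfolding abs_mult using small[of "Suc (m + i)"] bound Suc.prems \<delta> by (intro mult_mono) auto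
    thus ?case using Suc rec[of "m + i"] by (simp add: algebra_simps)
  qed (simp add: d_def)
  have "\<bar>w (m + i) - w m - real i * d\<bar> \<le> real i * (real L * (\<delta> * M))" if "i \<le> L" for i
    using that
  proof (induction i)
    case (Suc i)
    have "real i * (\<delta> * M) \<le> real L * (\<delta> * M)"
      using Suc.prems M by (intro mult_right_mono) auto
    thus ?case using Suc slope[of i] by (simp add: algebra_simps)
  qed simp
  from this[of L] have "\<bar>real L * d\<bar> \<le> \<bar>w (m + L) - w m\<bar> + real L * (real L * (\<delta> * M))"
    by linarith
  hence "real L * \<bar>d\<bar> \<le> \<bar>w (m + L) - w m\<bar> + real L * (real L * (\<delta> * M))"
    by (simp add: abs_mult)
  also have "\<bar>w (m + L) - w m\<bar> \<le> 2 * M" using bound[of m] bound[of "m + L"] by linarith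
  finally show ?thesis by (simp add: d_def)
qed

text \<open>
  On a window without coefficients far from \<open>2\<close> both solutions would have small slopes; but the
  Wronskian is bilinear in values and slopes and equals \<open>1\<close>.
\<close>

lemma bounded_imp_recurring_coefficients:
  fixes b :: "nat \<Rightarrow> real"
  assumes "bounded (range (three_term b 1 0))" "bounded (range (three_term b 0 1))"
  shows "\<exists>\<delta>>0. \<exists>L. \<forall>m. \<exists>k. m < k \<and> k \<le> m + L \<and> \<delta> < \<bar>b k - 2\<bar>"
proof -
  define p q where "p = three_term b 1 0" and "q = three_term b 0 1"
  obtain M1 M2 where M12: "\<And>n. \<bar>p n\<bar> \<le> M1" "\<And>n. \<bar>q n\<bar> \<le> M2"
    using assms unfolding p_def q_def bounded_iff by auto
  define M where "M = max 1 (max M1 M2)"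
  have M: "1 \<le> M" "\<And>n. \<bar>p n\<bar> \<le> M" "\<And>n. \<bar>q n\<bar> \<le> M"
    using M12 by (auto simp: M_def le_max_iff_disj)
  \<comment> \<open>\<open>L\<close> and \<open>\<delta>\<close> make each of the two terms that bound the Wronskian at most \<open>1/4\<close>.\<close>
  obtain L :: nat where L: "16 * M\<^sup>2 \<le> real L" using real_arch_simple by blast
  have M2: "0 < M\<^sup>2" using M(1) by simp
  hence L0: "0 < real L" using L by linarith
  define \<delta> where "\<delta> = 1 / (8 * M\<^sup>2 * real L)"
  have \<delta>: "0 < \<delta>" using M2 L0 by (simp add: \<delta>_def)
  have "\<exists>k. m < k \<and> k \<le> m + L \<and> \<delta> < \<bar>b k - 2\<bar>" for m
  proof (rule ccontr)
    assume "\<not> ?thesis"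
    hence small: "\<And>k. m < k \<Longrightarrow> k \<le> m + L \<Longrightarrow> \<bar>b k - 2\<bar> \<le> \<delta>" by force
    define s where "s = 2 * M / real L + real L * (\<delta> * M)"
    have slope: "\<bar>w (Suc m) - w m\<bar> \<le> s"
      if "w = p \<or> w = q" for w
    proof -
      have "real L * \<bar>w (Suc m) - w m\<bar> \<le> 2 * M + real L * (real L * (\<delta> * M))"
        using that M(2,3) small \<delta>
        by (intro slope_bound[where e = "\<lambda>k. b k - 2"]) (auto simp: p_def q_def algebra_simps)
      also have "\<dots> = real L * s" using L0 by (simp add: s_def field_simps)
      finally show ?thesis using L0 by simp
    qed
    have "1 = p m * q (Suc m) - p (Suc m) * q m"
      by (simp only: p_def q_def three_term_wronskian)
    also have "\<dots> = p m * (q (Suc m) - q m) - q m * (p (Suc m) - p m)"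
      by (simp add: algebra_simps)
    also have "\<dots> \<le> \<bar>p m\<bar> * \<bar>q (Suc m) - q m\<bar> + \<bar>q m\<bar> * \<bar>p (Suc m) - p m\<bar>"
      unfolding abs_mult[symmetric] by linarith
    also have "\<dots> \<le> M * s + M * s"
      using M slope by (intro add_mono mult_mono) auto
    also have "\<dots> = 4 * M\<^sup>2 / real L + 2 * (\<delta> * (M\<^sup>2 * real L))"
      by (simp add: s_def power2_eq_square algebra_simps)
    also have "\<delta> * (M\<^sup>2 * real L) = 1 / 8"
      using M2 L0 by (simp add: \<delta>_def)
    also have "4 * M\<^sup>2 / real L \<le> 1 / 4"
      using L L0 by (simp add: pos_divide_le_eq)
    finally show False by simp
  qed
  thus ?thesis using \<delta> by blast
qed

section \<open>Exponential growth at \<open>\<i>\<close>\<close>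

text \<open>
  Since \<open>s \<ge> 2\<close>, the sequence is convex, hence increasing; where \<open>s k \<ge> 2 + \<epsilon>\<close> it increases by at least \<open>\<epsilon> a k\<close>,
  which is a fixed proportion of any earlier value.
\<close>

lemma growth_of_convex_recurrence:
  fixes a s :: "nat \<Rightarrow> real"
  assumes a0: "a 0 = 0" "a 1 = 1"
    and rec: "\<And>k. s (Suc k) * a (Suc k) - a k \<le> a (Suc (Suc k))"
    and s: "\<And>k. 2 \<le> s k" and \<epsilon>: "0 \<le> \<epsilon>"
    and large: "\<And>m. \<exists>k. m < k \<and> k \<le> m + L \<and> 2 + \<epsilon> \<le> s k"
  shows "(1 + \<epsilon>) ^ j \<le> a (Suc (j * Suc L))"
proof -
  have inc: "0 \<le> a k \<and> a k \<le> a (Suc k)" for k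
  proof (induction k)
    case (Suc k)
    have "2 * a (Suc k) \<le> s (Suc k) * a (Suc k)"
      using s Suc by (intro mult_right_mono) auto
    thus ?case using Suc rec[of k] by linarith
  qed (use a0 in auto)
  have mono: "a m \<le> a n" if "m \<le> n" for m n
    by (rule lift_Suc_mono_le[of a, OF conjunct2[OF inc] that])
  have gain: "(1 + \<epsilon>) * a m \<le> a (m + Suc L)" for m
  proof -
    obtain k where k: "m < k" "k \<le> m + L" "2 + \<epsilon> \<le> s k" using large by blast
    then obtain i where i: "k = Suc i" by (cases k) auto
    have "(2 + \<epsilon>) * a k \<le> s k * a k" using k inc by (intro mult_right_mono) auto
    hence "(1 + \<epsilon>) * a k \<le> a (Suc k)"
      using rec[of i] inc[of i] unfolding i by (simp add: algebra_simps)
    moreover have "(1 + \<epsilon>) * a m \<le> (1 + \<epsilon>) * a k"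
      using mono[of m k] k \<epsilon> by (intro mult_left_mono) auto
    moreover have "a (Suc k) \<le> a (m + Suc L)" using k by (intro mono) auto
    ultimately show ?thesis by linarith
  qed
  show ?thesis
  proof (induction j)
    case (Suc j)
    have "(1 + \<epsilon>) ^ Suc j \<le> (1 + \<epsilon>) * a (Suc (j * Suc L))"
      using Suc \<epsilon> by (simp add: mult_left_mono)
    also have "\<dots> \<le> a (Suc (j * Suc L) + Suc L)" by (rule gain)
    also have "Suc (j * Suc L) + Suc L = Suc (Suc j * Suc L)" by simp
    finally show ?case .
  qed (use a0 in simp)
qed

lemma cmod_two_plus_ii: "cmod (2 + \<i> * of_real x) = sqrt (4 + x\<^sup>2)"
  by (simp add: cmod_def)

lemma growth_at_ii:
  fixes c :: "nat \<Rightarrow> real"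
  assumes \<delta>: "0 < \<delta>" and large: "\<And>m. \<exists>k. m < k \<and> k \<le> m + L \<and> \<delta> \<le> \<bar>c k\<bar>"
  obtains \<epsilon> where "0 < \<epsilon>"
    "\<And>j. (1 + \<epsilon>) ^ j \<le> cmod (three_term (\<lambda>k. 2 + \<i> * of_real (c k)) 0 1 (Suc (j * Suc L)))"
proof
  define \<epsilon> where "\<epsilon> = sqrt (4 + \<delta>\<^sup>2) - 2"
  have "sqrt 4 < sqrt (4 + \<delta>\<^sup>2)" using \<delta> by (intro real_sqrt_less_mono) simp
  thus \<epsilon>: "0 < \<epsilon>" by (simp add: \<epsilon>_def)
  fix j
  show "(1 + \<epsilon>) ^ j \<le> cmod (three_term (\<lambda>k. 2 + \<i> * of_real (c k)) 0 1 (Suc (j * Suc L)))"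
  proof (rule growth_of_convex_recurrence[where s = "\<lambda>k. sqrt (4 + (c k)\<^sup>2)"])
    fix k
    let ?a = "three_term (\<lambda>k. 2 + \<i> * of_real (c k)) 0 1"
    show "sqrt (4 + (c (Suc k))\<^sup>2) * cmod (?a (Suc k)) - cmod (?a k) \<le> cmod (?a (Suc (Suc k)))"
      using norm_triangle_ineq2[of "(2 + \<i> * of_real (c (Suc k))) * ?a (Suc k)" "?a k"]
      by (simp add: norm_mult cmod_two_plus_ii)
    have "sqrt 4 \<le> sqrt (4 + (c k)\<^sup>2)" by (intro real_sqrt_le_mono) simp
    thus "2 \<le> sqrt (4 + (c k)\<^sup>2)" by simp
  next
    fix m
    obtain k where k: "m < k" "k \<le> m + L" "\<delta> \<le> \<bar>c k\<bar>" using large by blast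
    have "\<delta>\<^sup>2 \<le> (c k)\<^sup>2" using k \<delta> by (simp add: abs_le_square_iff[symmetric])
    hence "2 + \<epsilon> \<le> sqrt (4 + (c k)\<^sup>2)" by (simp add: \<epsilon>_def)
    thus "\<exists>k. m < k \<and> k \<le> m + L \<and> 2 + \<epsilon> \<le> sqrt (4 + (c k)\<^sup>2)" using k by blast
  qed (use \<epsilon> in auto)
qed

section \<open>The measure of the stable set\<close>

lemma exponential_exceeds_linear:
  fixes \<sigma> D :: real
  assumes \<sigma>: "1 < \<sigma>"
  shows "\<exists>j. D * real (Suc (j * Suc L)) < \<sigma> ^ j"
proof -
  have "(\<lambda>j. real j * (1 / \<sigma>) ^ j) \<longlonglongrightarrow> 0"
    using \<sigma> powser_times_n_limit_0[of "1 / \<sigma>"] by simp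
  moreover have "(\<lambda>j. (1 / \<sigma>) ^ j) \<longlonglongrightarrow> 0"
    using \<sigma> by (intro LIMSEQ_power_zero) simp
  ultimately have "(\<lambda>j. D * ((1 / \<sigma>) ^ j + real (Suc L) * (real j * (1 / \<sigma>) ^ j))) \<longlonglongrightarrow> D * (0 + real (Suc L) * 0)"
    by (intro tendsto_mult tendsto_add tendsto_const)
  hence "\<forall>\<^sub>F j in sequentially. D * ((1 / \<sigma>) ^ j + real (Suc L) * (real j * (1 / \<sigma>) ^ j)) < 1"
    by (rule order_tendstoD) simp
  then obtain j where "D * ((1 / \<sigma>) ^ j + real (Suc L) * (real j * (1 / \<sigma>) ^ j)) < 1"
    using eventually_happens'[OF sequentially_bot] by blast
  hence "D * real (Suc (j * Suc L)) / \<sigma> ^ j < 1"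
    by (simp add: power_one_over algebra_simps add_divide_distrib)
  thus ?thesis using \<sigma> by (auto simp: divide_less_eq intro!: exI[of _ j])
qed

lemma stable_parameters_borel: "stable_parameters c \<in> sets borel"
  unfolding stable_parameters_alt
  by (intro sets.Int sets_bounded_range continuous_on_three_term) auto

text \<open>
  Lower bound \<open>\<sigma>\<^bsup>2j\<^esup>\<close> and upper bound \<open>O(j \<sigma>\<^sup>j)\<close> for \<open>\<bar>Q\<^sub>n(\<i>)\<bar>\<close> along \<open>n = j (L + 1) + 1\<close>, where \<open>L\<close> is the length
  of a window.
\<close>

lemma emeasure_stable_parameters_finite: "emeasure lborel (stable_parameters c) < \<infinity>"
proof (rule ccontr)
  let ?q = "\<lambda>t. three_term (\<lambda>k. 2 + t * c k) 0 1"
  assume "\<not> ?thesis"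
  hence inf: "emeasure lborel (stable_parameters c) = \<infinity>"
    by (simp add: less_top[symmetric])
  hence "stable_parameters c \<noteq> {}" by auto
  then obtain t where t: "t \<in> stable_parameters c" by blast
  then obtain \<delta> L where \<delta>: "0 < \<delta>" and L: "\<And>m. \<exists>k. m < k \<and> k \<le> m + L \<and> \<delta> < \<bar>(2 + t * c k) - 2\<bar>"
    using bounded_imp_recurring_coefficients[of "\<lambda>k. 2 + t * c k"] unfolding stable_parameters_alt by blast
  have "t \<noteq> 0" using L[of 0] \<delta> by auto
  hence t0: "0 < t" using t by (simp add: stable_parameters_def)
  have "\<exists>k. m < k \<and> k \<le> m + L \<and> \<delta> / t \<le> \<bar>c k\<bar>" for m
    using L[of m] t0 by (auto simp: abs_mult pos_divide_le_eq mult.commute intro: less_imp_le)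
  then obtain \<epsilon> where \<epsilon>: "0 < \<epsilon>" and growth:
    "\<And>j. (1 + \<epsilon>) ^ j \<le> cmod (three_term (\<lambda>k. 2 + \<i> * of_real (c k)) 0 1 (Suc (j * Suc L)))"
    using growth_at_ii[of "\<delta> / t" L c] \<delta> t0 by (metis divide_pos_pos)

  define F where "F C = {0..} \<inter> {t. \<forall>n. \<bar>?q t n\<bar> \<le> real C}" for C
  have F: "F C \<in> sets borel" "F C \<subseteq> {0..}" for C
    using closed_uniformly_bounded_by[of "\<lambda>n t. ?q t n" "real C"] continuous_on_three_term[of UNIV c 0 1]
    by (auto simp: F_def intro!: sets.Int borel_closed)
  have incF: "incseq F"
    unfolding incseq_def F_def using order.trans of_nat_mono by blast
  have "stable_parameters c \<subseteq> (\<Union>C. F C)"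
  proof
    fix s assume s: "s \<in> stable_parameters c"
    then obtain M where M: "\<And>n. \<bar>?q s n\<bar> \<le> M"
      unfolding stable_parameters_alt bounded_iff by auto
    obtain C :: nat where "M \<le> real C" using real_arch_simple by blast
    hence "\<bar>?q s n\<bar> \<le> real C" for n using M[of n] by linarith
    thus "s \<in> (\<Union>C. F C)" using s by (auto simp: F_def stable_parameters_def)
  qed
  hence "emeasure lborel (stable_parameters c) \<le> emeasure lborel (\<Union>C. F C)"
    using F by (intro emeasure_mono) auto
  hence infF: "emeasure lborel (\<Union>C. F C) = \<infinity>"
    using inf by (simp add: top_unique)

  define \<sigma> where "\<sigma> = sqrt (1 + \<epsilon>)"
  have \<sigma>: "1 < \<sigma>" "\<sigma> * \<sigma> = 1 + \<epsilon>" using \<epsilon> by (auto simp: \<sigma>_def)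
  \<comment> \<open>With this \<open>\<kappa>\<close> the upper bound grows by \<open>\<sigma>\<close> per window, whereas \<open>Q\<^sub>n(\<i>)\<close> grows at least by \<open>\<sigma>\<^sup>2\<close>.\<close>
  define \<kappa> where "\<kappa> = ln \<sigma> / real (Suc L)"
  have \<kappa>: "0 < \<kappa>" using \<sigma> by (simp add: \<kappa>_def)
  obtain A C where nodes: "\<And>n. \<exists>X. good_nodes (F C) n (A * exp (\<kappa> * n)) X"
    using node_rate_all[OF F(1) incF F(2) infF \<kappa>] by blast
  define B where "B k = [:2, complex_of_real (c k):]" for k
  have poly_q: "poly (three_term B 0 1 n) z = three_term (\<lambda>k. 2 + z * of_real (c k)) 0 1 n" for n z
    by (simp add: poly_three_term B_def)
  have upper: "(1 + \<epsilon>) ^ j \<le> (real C * A * exp \<kappa>) * real (Suc (j * Suc L)) * \<sigma> ^ j" for j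
  proof -
    define n where "n = Suc (j * Suc L)"
    obtain X where "good_nodes (F C) n (A * exp (\<kappa> * n)) X" using nodes by blast
    hence X: "finite X" "X \<subseteq> F C" "card X = n" "\<And>x. x \<in> X \<Longrightarrow> node_factor X x \<le> A * exp (\<kappa> * n)"
      unfolding good_nodes_def by simp_all
    have "cmod (poly (three_term B 0 1 n) \<i>) \<le> card X * (real C * (A * exp (\<kappa> * n)))"
    proof (rule interpolation_bound[OF X(1) _ _ X(4)])
      have "degree (three_term B 0 1 n) \<le> j * Suc L"
        unfolding n_def by (rule degree_three_term) (simp add: B_def)
      thus "degree (three_term B 0 1 n) < card X" by (simp add: X(3) n_def)
    next
      fix x assume "x \<in> X"
      have "poly (three_term B 0 1 n) (of_real x) = of_real (?q x n)"
        using three_term_of_real[of "\<lambda>k. 2 + x * c k" 0 1 n, where 'a = complex] by (simp add: poly_q)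
      thus "cmod (poly (three_term B 0 1 n) (of_real x)) \<le> real C"
        using \<open>x \<in> X\<close> X(2) by (auto simp: F_def)
    qed
    moreover have "(1 + \<epsilon>) ^ j \<le> cmod (poly (three_term B 0 1 n) \<i>)"
      using growth[of j] by (simp only: poly_q n_def)
    moreover have "exp (\<kappa> * n) = exp \<kappa> * \<sigma> ^ j"
    proof -
      have "\<kappa> * n = \<kappa> + ln \<sigma> * real j"
        by (simp add: n_def \<kappa>_def field_simps)
      thus ?thesis using \<sigma>(1) by (simp only: exp_add exp_of_nat2_mult) simp
    qed
    ultimately show ?thesis
      unfolding X(3) n_def[symmetric] by (simp only: mult_ac)
  qed
  obtain j where j: "real C * A * exp \<kappa> * real (Suc (j * Suc L)) < \<sigma> ^ j"
    using exponential_exceeds_linear[OF \<sigma>(1)] by blast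
  have "0 < \<sigma> ^ j" using \<sigma> by simp
  have "(1 + \<epsilon>) ^ j = \<sigma> ^ j * \<sigma> ^ j" by (simp only: \<sigma>(2)[symmetric] power_mult_distrib)
  hence "\<sigma> ^ j \<le> real C * A * exp \<kappa> * real (Suc (j * Suc L))"
    using upper[of j] \<open>0 < \<sigma> ^ j\<close> by (simp only: mult_le_cancel_right_pos)
  thus False using j by linarith
qed

theorem corollary1:
  fixes c :: "nat \<Rightarrow> real"
  shows "stable_parameters c \<in> sets lebesgue \<and> emeasure lebesgue (stable_parameters c) < \<infinity>"
  using stable_parameters_borel[of c] emeasure_stable_parameters_finite[of c] by simp

end
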